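(* Let $0<q<1$, let $f$ be a continuous function on $[0,1]$, and let $n\ge1$ be an integer. Then for $x\in[0,1]$, $$\mathbb{B}_{n,q}(f\mid x)=\sum_{k=0}^n\binom{n}{k}[x]_q^k\,\Delta^k f(0),$$ where $\Delta$ is the forward difference operator with step $1/n$, i.e. $\Delta g(y)=g(y+\tfrac1n)-g(y)$, so that $\Delta^k f(0)=\sum_{j=0}^k\binom{k}{j}(-1)^{k-j}f\!\left(\frac jn\right)$.
   Context: For $r>0$, $r\ne1$ and real $y$, $[y]_r=\frac{1-r^y}{1-r}$. For integers $0\le k\le n$ and $x\in[0,1]$, $B_{k,n}(x,q)=\binom nk[x]_q^k[1-x]_{1/q}^{\,n-k}$. For $f\in C[0,1]$ and an integer $n\ge1$, $\mathbb{B}_{n,q}(f\mid x)=\sum_{k=0}^n f\!\left(\frac kn\right)B_{k,n}(x,q)$. *)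

theory Defs
  imports Complex_Main
begin

text \<open>The \<open>q\<close>-number \<open>[y]\<^sub>r\<close>; meaningful for \<open>r > 0\<close>, \<open>r \<noteq> 1\<close>.\<close>

definition q_number :: "real \<Rightarrow> real \<Rightarrow> real" where
  "q_number r y = (1 - r powr y) / (1 - r)"

definition q_bernstein_basis :: "nat \<Rightarrow> nat \<Rightarrow> real \<Rightarrow> real \<Rightarrow> real" where
  "q_bernstein_basis k n x q =
     real (n choose k) * q_number q x ^ k * q_number (1 / q) (1 - x) ^ (n - k)"

definition q_bernstein :: "nat \<Rightarrow> real \<Rightarrow> (real \<Rightarrow> real) \<Rightarrow> real \<Rightarrow> real" where
  "q_bernstein n q f x = (\<Sum>k = 0..n. f (real k / real n) * q_bernstein_basis k n x q)"

text \<open>The forward difference operator with step \<open>h\<close>; its powers are the iterates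
  \<open>forward_diff h ^^ k\<close>. For \<open>h = 1/n\<close> and \<open>k \<le> n\<close>, the \<open>k\<close>-th iterate at \<open>0\<close>
  evaluates the function only at points of \<open>[0, 1]\<close>.\<close>

definition forward_diff :: "real \<Rightarrow> (real \<Rightarrow> real) \<Rightarrow> real \<Rightarrow> real" where
  "forward_diff h g y = g (y + h) - g y"

end

theory Submission
  imports Defs
begin

text \<open>Since \<open>[1 - x]\<^bsub>1/q\<^esub> = 1 - [x]\<^sub>q\<close>, the operator is the classical Bernstein polynomial
  evaluated at \<open>t = [x]\<^sub>q\<close>, that is \<open>((1 - t) I + t E)\<^sup>n f\<close> at \<open>0\<close>, where \<open>E\<close> is the shift by
  \<open>1/n\<close>. As \<open>E = I + \<Delta>\<close>, this equals \<open>(I + t \<Delta>)\<^sup>n f\<close> at \<open>0\<close>.\<close>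

text \<open>Pascal's rule in operator form: if \<open>S\<close> shifts the sequence \<open>c\<close>
  by one index, the sum is \<open>(b I + a S)^n\<close> applied to \<open>c\<close> at index 0, and
  one factor is split off. It is used below with \<open>(a, b)\<close> equal to
  \<open>(1, -1)\<close>, \<open>(t, 1 - t)\<close> and \<open>(t, 1)\<close>.\<close>

lemma binomial_sum_Suc:
  fixes a b :: "'a::comm_semiring_1"
  shows "(\<Sum>k\<le>Suc n. of_nat (Suc n choose k) * a ^ k * b ^ (Suc n - k) * c k) =
    b * (\<Sum>k\<le>n. of_nat (n choose k) * a ^ k * b ^ (n - k) * c k) +
    a * (\<Sum>k\<le>n. of_nat (n choose k) * a ^ k * b ^ (n - k) * c (Suc k))"
proof -
  have "(\<Sum>k\<le>Suc n. of_nat (Suc n choose k) * a ^ k * b ^ (Suc n - k) * c k) =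
      (b ^ Suc n * c 0 + (\<Sum>k\<le>n. of_nat (n choose Suc k) * a ^ Suc k * b ^ (n - k) * c (Suc k))) +
      (\<Sum>k\<le>n. of_nat (n choose k) * a ^ Suc k * b ^ (n - k) * c (Suc k))"
    by (subst sum.atMost_Suc_shift) (simp add: sum.distrib algebra_simps)
  also have "b ^ Suc n * c 0 +
      (\<Sum>k\<le>n. of_nat (n choose Suc k) * a ^ Suc k * b ^ (n - k) * c (Suc k)) =
      (\<Sum>k\<le>Suc n. of_nat (n choose k) * a ^ k * b ^ (Suc n - k) * c k)"
    by (subst sum.atMost_Suc_shift) simp
  \<comment> \<open>The top term \<open>k = Suc n\<close> vanishes because
    \<open>n choose Suc n\<close> is 0; every other term has a spare factor
    \<open>b\<close>.\<close>
  also have "\<dots> = b * (\<Sum>k\<le>n. of_nat (n choose k) * a ^ k * b ^ (n - k) * c k)"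
    by (simp add: sum_distrib_left Suc_diff_le binomial_eq_0 mult_ac)
  also have "(\<Sum>k\<le>n. of_nat (n choose k) * a ^ Suc k * b ^ (n - k) * c (Suc k)) =
      a * (\<Sum>k\<le>n. of_nat (n choose k) * a ^ k * b ^ (n - k) * c (Suc k))"
    by (simp add: sum_distrib_left mult_ac)
  finally show ?thesis .
qed

lemma forward_diff_funpow_Suc:
  "(forward_diff h ^^ Suc k) g y = (forward_diff h ^^ k) g (y + h) - (forward_diff h ^^ k) g y"
  by (simp add: forward_diff_def)

text \<open>Binomial expansion of \<open>(E - I)^k\<close>, with \<open>E\<close> the shift by
  \<open>h\<close>. The induction keeps \<open>y\<close> arbitrary because the step uses the
  hypothesis at \<open>y + h\<close> as well as at \<open>y\<close>.\<close>

lemma forward_diff_funpow: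
  "(forward_diff h ^^ k) g y =
    (\<Sum>j\<le>k. real (k choose j) * (-1) ^ (k - j) * g (y + real j * h))"
proof (induction k arbitrary: y)
  case 0
  show ?case by simp
next
  case (Suc k)
  show ?case
    using binomial_sum_Suc[where n = k and a = 1 and b = "-1 :: real"
        and c = "\<lambda>j. g (y + real j * h)"]
    unfolding forward_diff_funpow_Suc Suc by (simp add: algebra_simps)
qed

lemma bernstein_sum_eq_forward_diff_sum:
  fixes t :: real
  shows "(\<Sum>k\<le>n. real (n choose k) * t ^ k * (1 - t) ^ (n - k) * g (y + real k * h)) =
    (\<Sum>k\<le>n. real (n choose k) * t ^ k * (forward_diff h ^^ k) g y)"
proof (induction n arbitrary: y)
  case 0
  show ?case by simp
next
  case (Suc n)
  let ?D = "\<lambda>y. \<Sum>k\<le>n. real (n choose k) * t ^ k * (forward_diff h ^^ k) g y"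
  have "(\<Sum>k\<le>Suc n. real (Suc n choose k) * t ^ k * (1 - t) ^ (Suc n - k) * g (y + real k * h)) =
      (1 - t) * ?D y + t * ?D (y + h)"
    unfolding binomial_sum_Suc Suc[symmetric] by (simp add: algebra_simps)
  \<comment> \<open>Regrouped as \<open>?D y + t * (?D (y + h) - ?D y)\<close>; the difference of
    the two sums raises the order of each iterate by one.\<close>
  also have "\<dots> = ?D y +
      t * (\<Sum>k\<le>n. real (n choose k) * t ^ k * (forward_diff h ^^ Suc k) g y)"
    unfolding forward_diff_funpow_Suc by (simp add: right_diff_distrib sum_subtractf algebra_simps)
  \<comment> \<open>Pascal's rule read backwards, with \<open>b = 1\<close> as the coefficient of
    \<open>I\<close> in \<open>I + t \<Delta>\<close>.\<close>
  also have "\<dots> = (\<Sum>k\<le>Suc n. real (Suc n choose k) * t ^ k * (forward_diff h ^^ k) g y)"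
    using binomial_sum_Suc[where n = n and a = t and b = 1
        and c = "\<lambda>k. (forward_diff h ^^ k) g y"]
    by (simp del: sum.atMost_Suc funpow.simps)
  finally show ?case .
qed

text \<open>Multiplying numerator and denominator of the left side by \<open>q\<close> gives
  \<open>(q - q powr x) / (q - 1)\<close>, which is
  \<open>1 - (1 - q powr x) / (1 - q)\<close>.\<close>

lemma q_number_inverse_base:
  assumes "0 < q" and "q \<noteq> 1"
  shows "q_number (1 / q) (1 - x) = 1 - q_number q x"
proof -
  have "(1 / q) powr (1 - x) = q powr x / q"
    using assms by (simp add: powr_divide powr_diff)
  then show ?thesis
    using assms by (simp add: q_number_def divide_simps) (simp add: algebra_simps)
qed

theorem theorem4:
  fixes q :: real and f :: "real \<Rightarrow> real" and n :: nat and x :: real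
  assumes "0 < q" and "q < 1"
    and "continuous_on {0..1} f"
    and "n \<ge> 1"
    and "x \<in> {0..1}"
  shows "q_bernstein n q f x =
      (\<Sum>k = 0..n. real (n choose k) * q_number q x ^ k * (forward_diff (1 / real n) ^^ k) f 0)
    \<and> (\<forall>k\<le>n. (forward_diff (1 / real n) ^^ k) f 0 =
        (\<Sum>j = 0..k. real (k choose j) * (-1) ^ (k - j) * f (real j / real n)))"
proof
  show "q_bernstein n q f x =
      (\<Sum>k = 0..n. real (n choose k) * q_number q x ^ k * (forward_diff (1 / real n) ^^ k) f 0)"
    \<comment> \<open>With \<open>y = 0\<close> and \<open>h = 1 / real n\<close>, the points
      \<open>y + real k * h\<close> become the nodes \<open>real k / real n\<close>.\<close>
    using bernstein_sum_eq_forward_diff_sum[where n = n and t = "q_number q x" and g = f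
        and y = 0 and h = "1 / real n"] assms(1,2)
    by (simp add: q_bernstein_def q_bernstein_basis_def q_number_inverse_base
        atMost_atLeast0 mult_ac)
  show "\<forall>k\<le>n. (forward_diff (1 / real n) ^^ k) f 0 =
      (\<Sum>j = 0..k. real (k choose j) * (-1) ^ (k - j) * f (real j / real n))"
    by (simp add: forward_diff_funpow atMost_atLeast0)
qed

end
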